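(* Let $G=(V,E)$ be a connected, undirected, unweighted graph with shortest-path distance $\mathrm{dist}(\cdot,\cdot)$, and let $L$ be a hub labeling of $G$ satisfying the cover property. Let $P=(P_0,\dots,P_{|P|-1})$ be a list of pairwise distinct vertices (the objects), let $k\ge 1$ be an integer with $|P|\ge k+1$, and let $q\in V$ be a query vertex. Then the ReHub algorithm (offline phase followed by online phase, as described in the context) is correct: the vector $\mathit{out}$ it outputs satisfies, for every index $i\in\{0,\dots,|P|-1\}$, $$\mathit{out}[i]=\begin{cases}\mathrm{dist}(q,P_i) & \text{if } P_i\in \mathrm{R}k\mathrm{NN}(q),\\ \infty & \text{otherwise,}\end{cases}$$ where $\mathrm{R}k\mathrm{NN}(q)=\{P_i : \mathrm{dist}(P_i,q)\le d_k(P_i)\}$ and $d_k(P_i)$ is the distance from $P_i$ to its $k$-th nearest neighbor among the other objects $P\setminus\{P_i\}$. In particular, the algorithm returns exactly the reverse $k$-nearest-neighbor set of $q$ together with the correct network distances from $q$ to its members.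
   Context: Hub labeling: every vertex $v$ has a label $L(v)$, a list of pairs $(u,\mathrm{dist}(v,u))$ with $u\in V$ (the hubs of $v$), sorted by hub. Cover property: for all $s,t\in V$, $L(s)\cap L(t)$ (as sets of hubs) contains at least one vertex on a shortest $s$–$t$ path; hence $\mathrm{dist}(s,t)=\min_{u\in L(s)\cap L(t)}(\mathrm{dist}(s,u)+\mathrm{dist}(u,t))$. For an object $p\in P$, its $k$-th nearest neighbor $p_k$ is an object of $P\setminus\{p\}$ such that exactly fewer than $k$ objects of $P\setminus\{p\}$ are strictly closer to $p$ and at least $k$ are at distance $\le \mathrm{dist}(p,p_k)$; $d_k(p)=\mathrm{dist}(p,p_k)$ (the $k$-th smallest value in the multiset $\{\mathrm{dist}(p,p'):p'\in P\setminus\{p\}\}$). The reverse $k$NN query is $\mathrm{R}k\mathrm{NN}(q)=\{p\in P:\mathrm{dist}(p,q)\le d_k(p)\}$. ReHub algorithm. Offline phase: (1) $k$NN backward labels: for each hub $u$, $\mathrm{kNNLab}[u]$ is the list of at most $k+1$ pairs $(i,\mathrm{dist}(P_i,u))$, over all objects $P_i$ having $u$ in $L(P_i)$, with the smallest distances (ties broken arbitrarily), sorted by distance. (2) Batch $k$NN: for each object index $i$, over all pairs $(u,d)\in L(P_i)$ and all pairs $(j,d')\in \mathrm{kNNLab}[u]$ with $j\ne i$, form candidate $(j,d+d')$; for each $j$ keep the minimum candidate distance, and let $\mathrm{kNNResults}[i]$ be the $k$ resulting pairs with smallest distances, sorted by distance; write $\mathrm{kNNResults}[i][k-1].\mathrm{dist}$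 for the $k$-th smallest. (3) RkNN backward labels: for each object index $i$ and each pair $(u,d)\in L(P_i)$ with $d\le \mathrm{kNNResults}[i][k-1].\mathrm{dist}$, append $(i,d)$ to $\mathrm{RkNNLab}[u]$. Online phase for query $q$: initialize $\mathit{out}[i]=\infty$ for all $i$; for each $(u,d)\in L(q)$ and each $(i,d')\in\mathrm{RkNNLab}[u]$, set $d_2=d+d'$ and if $d_2<\mathit{out}[i]$ and $d_2\le \mathrm{kNNResults}[i][k-1].\mathrm{dist}$, set $\mathit{out}[i]=d_2$. Output $\mathit{out}$. *)

theory Defs
  imports "Graph_Theory.Graph_Theory" "HOL-Library.Multiset"
begin

text \<open>An undirected graph is a symmetric digraph. The distance is the minimum number of arcs of a
  walk: the library's \<open>\<mu>\<close>, with every arc of weight 1.\<close>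

definition gdist :: "('v, 'e) pre_digraph \<Rightarrow> 'v \<Rightarrow> 'v \<Rightarrow> ereal" where
  "gdist G u v = wf_digraph.\<mu> G (\<lambda>_. 1) u v"

definition on_shortest_path :: "('v, 'e) pre_digraph \<Rightarrow> 'v \<Rightarrow> 'v \<Rightarrow> 'v \<Rightarrow> bool" where
  "on_shortest_path G s t u \<longleftrightarrow>
     (\<exists>p. pre_digraph.apath G s p t \<and> ereal (length p) = gdist G s t
        \<and> u \<in> set (pre_digraph.awalk_verts G s p))"


type_synonym 'v labeling = "'v \<Rightarrow> ('v \<times> ereal) list"

definition hub_labeling :: "('v::linorder, 'e) pre_digraph \<Rightarrow> 'v labeling \<Rightarrow> bool" where
  "hub_labeling G L \<longleftrightarrow>
     (\<forall>v \<in> verts G. sorted (map fst (L v)) \<and>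
        (\<forall>(u, d) \<in> set (L v). u \<in> verts G \<and> d = gdist G v u))"

definition hubs :: "'v labeling \<Rightarrow> 'v \<Rightarrow> 'v set" where
  "hubs L v = fst ` set (L v)"

definition cover_property :: "('v, 'e) pre_digraph \<Rightarrow> 'v labeling \<Rightarrow> bool" where
  "cover_property G L \<longleftrightarrow>
     (\<forall>s \<in> verts G. \<forall>t \<in> verts G. \<exists>u \<in> hubs L s \<inter> hubs L t. on_shortest_path G s t u)"


text \<open>For \<open>1 \<le> k \<le> card (set P - {p})\<close>, the \<open>k\<close>-th smallest distance from \<open>p\<close> to the other objects,
  counted with multiplicity.\<close>

definition kNN_dist :: "('v, 'e) pre_digraph \<Rightarrow> 'v list \<Rightarrow> nat \<Rightarrow> 'v \<Rightarrow> ereal" where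
  "kNN_dist G P k p =
     sorted_list_of_multiset (image_mset (gdist G p) (mset_set (set P - {p}))) ! (k - 1)"

definition RkNN :: "('v, 'e) pre_digraph \<Rightarrow> 'v list \<Rightarrow> nat \<Rightarrow> 'v \<Rightarrow> 'v set" where
  "RkNN G P k q = {p \<in> set P. gdist G p q \<le> kNN_dist G P k p}"

definition kth_nearest ::
    "('v, 'e) pre_digraph \<Rightarrow> 'v list \<Rightarrow> nat \<Rightarrow> 'v \<Rightarrow> 'v \<Rightarrow> bool" where
  "kth_nearest G P k p r \<longleftrightarrow> r \<in> set P - {p}
     \<and> card {x \<in> set P - {p}. gdist G p x < gdist G p r} < k
     \<and> k \<le> card {x \<in> set P - {p}. gdist G p x \<le> gdist G p r}"

lemma kth_smallest_eq:
  fixes f :: "'a \<Rightarrow> 'b::linorder"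
  assumes fin: "finite A"
    and less: "card {x \<in> A. f x < v} < k" and le: "k \<le> card {x \<in> A. f x \<le> v}"
  shows "sorted_list_of_multiset (image_mset f (mset_set A)) ! (k - 1) = v"
proof -
  define ys where "ys = sorted_list_of_multiset (image_mset f (mset_set A))"
  have sorted: "sorted ys" and mset: "mset ys = image_mset f (mset_set A)"
    by (simp_all add: ys_def)
  have card_filter: "length (filter Q ys) = card {x \<in> A. Q (f x)}" for Q
  proof -
    have "length (filter Q ys) = size (filter_mset Q (mset ys))"
      by (metis mset_filter size_mset)
    also have "\<dots> = size (filter_mset (\<lambda>x. Q (f x)) (mset_set A))"
      by (simp add: mset filter_mset_image_mset)
    finally show ?thesis using fin by simp
  qed
  have len: "length ys = card A" using card_filter[of "\<lambda>_. True"] by simp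
  have "card {x \<in> A. f x \<le> v} \<le> card A" using fin by (intro card_mono) auto
  then have klen: "k - 1 < length ys" and kpos: "0 < k" using len less le by auto
  have "\<not> ys ! (k - 1) < v"
  proof
    assume lt: "ys ! (k - 1) < v"
    have "{..<k} \<subseteq> {i. i < length ys \<and> ys ! i < v}"
    proof
      fix i assume "i \<in> {..<k}"
      then have "i \<le> k - 1" by auto
      then have "ys ! i \<le> ys ! (k - 1)" using sorted klen by (simp add: sorted_nth_mono)
      then show "i \<in> {i. i < length ys \<and> ys ! i < v}" using lt klen \<open>i \<le> k - 1\<close> by auto
    qed
    then have "card {..<k} \<le> length (filter (\<lambda>y. y < v) ys)"
      unfolding length_filter_conv_card by (intro card_mono) auto
    then show False using card_filter[of "\<lambda>y. y < v"] less by simp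
  qed
  moreover have "\<not> v < ys ! (k - 1)"
  proof
    assume gt: "v < ys ! (k - 1)"
    have "{i. i < length ys \<and> ys ! i \<le> v} \<subseteq> {..<k - 1}"
    proof
      fix i assume i: "i \<in> {i. i < length ys \<and> ys ! i \<le> v}"
      show "i \<in> {..<k - 1}"
      proof (rule ccontr)
        assume "i \<notin> {..<k - 1}"
        then have "ys ! (k - 1) \<le> ys ! i" using sorted i by (intro sorted_nth_mono) auto
        then show False using gt i by auto
      qed
    qed
    then have "length (filter (\<lambda>y. y \<le> v) ys) \<le> card {..<k - 1}"
      unfolding length_filter_conv_card by (intro card_mono) auto
    then show False using card_filter[of "\<lambda>y. y \<le> v"] le kpos by simp
  qed
  ultimately show ?thesis by (simp add: ys_def)
qed

lemma kNN_dist_eq_kth_nearest: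
  assumes "kth_nearest G P k p r"
  shows "kNN_dist G P k p = gdist G p r"
  using assms unfolding kth_nearest_def kNN_dist_def
  by (intro kth_smallest_eq) auto


text \<open>\<open>smallest_pairs m C xs\<close>: \<open>xs\<close> lists, by increasing second component, \<open>m\<close> pairs of \<open>C\<close> with
  smallest second components (all of \<open>C\<close> if it has fewer than \<open>m\<close> pairs). Ties are broken
  arbitrarily, so \<open>xs\<close> is not unique, and the offline phase below is specified by relations.\<close>

definition smallest_pairs :: "nat \<Rightarrow> ('a \<times> 'd::linorder) set \<Rightarrow> ('a \<times> 'd) list \<Rightarrow> bool" where
  "smallest_pairs m C xs \<longleftrightarrow>
     distinct xs \<and> set xs \<subseteq> C \<and> length xs = min m (card C) \<and> sorted (map snd xs)
     \<and> (\<forall>x \<in> set xs. \<forall>y \<in> C - set xs. snd x \<le> snd y)"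

definition is_kNNLab ::
    "'v labeling \<Rightarrow> 'v list \<Rightarrow> nat \<Rightarrow> ('v \<Rightarrow> (nat \<times> ereal) list) \<Rightarrow> bool" where
  "is_kNNLab L P k lab \<longleftrightarrow>
     (\<forall>u. smallest_pairs (k + 1) {(i, d). i < length P \<and> (u, d) \<in> set (L (P ! i))} (lab u))"

definition candidates ::
    "'v labeling \<Rightarrow> 'v list \<Rightarrow> ('v \<Rightarrow> (nat \<times> ereal) list) \<Rightarrow> nat \<Rightarrow> (nat \<times> ereal) set" where
  "candidates L P lab i =
     {(j, d + d') | u d j d'. (u, d) \<in> set (L (P ! i)) \<and> (j, d') \<in> set (lab u) \<and> j \<noteq> i}"

definition best_candidates :: "('a \<times> 'd::linorder) set \<Rightarrow> ('a \<times> 'd) set" where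
  "best_candidates C = {(j, Min {d. (j, d) \<in> C}) | j. j \<in> fst ` C}"

definition is_kNNResults ::
    "'v labeling \<Rightarrow> 'v list \<Rightarrow> nat \<Rightarrow> ('v \<Rightarrow> (nat \<times> ereal) list) \<Rightarrow>
     (nat \<times> ereal) list list \<Rightarrow> bool" where
  "is_kNNResults L P k lab res \<longleftrightarrow>
     length res = length P \<and>
     (\<forall>i < length P. smallest_pairs k (best_candidates (candidates L P lab i)) (res ! i))"

definition RkNNLab ::
    "'v labeling \<Rightarrow> 'v list \<Rightarrow> nat \<Rightarrow> (nat \<times> ereal) list list \<Rightarrow> 'v \<Rightarrow> (nat \<times> ereal) list" where
  "RkNNLab L P k res u =
     [(i, d). i \<leftarrow> [0..<length P], (h, d) \<leftarrow> L (P ! i), h = u, d \<le> snd (res ! i ! (k - 1))]"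

definition online ::
    "'v labeling \<Rightarrow> 'v list \<Rightarrow> nat \<Rightarrow> (nat \<times> ereal) list list \<Rightarrow>
     ('v \<Rightarrow> (nat \<times> ereal) list) \<Rightarrow> 'v \<Rightarrow> ereal list" where
  "online L P k res rlab q =
     fold (\<lambda>(u, d). fold (\<lambda>(i, d') out.
         let d2 = d + d' in
         if d2 < out ! i \<and> d2 \<le> snd (res ! i ! (k - 1)) then out[i := d2] else out)
       (rlab u))
     (L q) (replicate (length P) \<infinity>)"

definition rehub_output ::
    "'v labeling \<Rightarrow> 'v list \<Rightarrow> nat \<Rightarrow> 'v \<Rightarrow> ereal list \<Rightarrow> bool" where
  "rehub_output L P k q out \<longleftrightarrow>
     (\<exists>lab res. is_kNNLab L P k lab \<and> is_kNNResults L P k lab res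
        \<and> out = online L P k res (RkNNLab L P k res) q)"

lemma ex_smallest_pairs:
  assumes "finite C"
  shows "\<exists>xs. smallest_pairs m C xs"
proof -
  obtain zs where zs: "set zs = C" "distinct zs" using assms finite_distinct_list by blast
  define ys where "ys = sort_key snd zs"
  have ys: "set ys = C" "distinct ys" "sorted (map snd ys)" using zs by (simp_all add: ys_def)
  have len: "length ys = card C" using ys distinct_card by fastforce
  have "snd x \<le> snd y" if x: "x \<in> set (take m ys)" and y: "y \<in> C - set (take m ys)" for x y
  proof -
    have "y \<in> set (drop m ys)" using y ys(1) append_take_drop_id[of m ys]
      by (metis DiffD1 DiffD2 Un_iff set_append)
    moreover have "sorted (map snd (take m ys) @ map snd (drop m ys))"
      using ys(3) by (simp flip: map_append)
    ultimately show ?thesis using x unfolding sorted_append by auto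
  qed
  moreover have "sorted (map snd (take m ys))"
    using ys(3) by (metis sorted_wrt_take take_map)
  ultimately have "smallest_pairs m C (take m ys)"
    unfolding smallest_pairs_def using ys(1,2) len set_take_subset[of m ys]
    by (simp add: min.commute)
  then show ?thesis ..
qed

lemma ex_rehub_output: "\<exists>out. rehub_output L P k q out"
proof -
  have "finite {(i, d). i < length P \<and> (u, d) \<in> set (L (P ! i))}" for u
  proof (rule finite_subset)
    show "{(i, d). i < length P \<and> (u, d) \<in> set (L (P ! i))} \<subseteq>
        (SIGMA i : {..<length P}. snd ` set (L (P ! i)))"
      by force
  qed auto
  then have "\<forall>u. \<exists>xs. smallest_pairs (k + 1)
      {(i, d). i < length P \<and> (u, d) \<in> set (L (P ! i))} xs"
    using ex_smallest_pairs by blast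
  from choice[OF this] obtain lab where lab: "is_kNNLab L P k lab"
    unfolding is_kNNLab_def by (rule exE)
  have "finite (candidates L P lab i)" for i
  proof (rule finite_subset)
    show "candidates L P lab i \<subseteq> (\<lambda>((u, d), (j, d')). (j, d + d')) `
        (SIGMA x : set (L (P ! i)). set (lab (fst x)))"
    proof
      fix x assume "x \<in> candidates L P lab i"
      then obtain u d j d' where "x = (j, d + d')" "(u, d) \<in> set (L (P ! i))"
        "(j, d') \<in> set (lab u)"
        unfolding candidates_def by blast
      then show "x \<in> (\<lambda>((u, d), (j, d')). (j, d + d')) `
          (SIGMA x : set (L (P ! i)). set (lab (fst x)))"
        by (intro image_eqI[of _ _ "((u, d), (j, d'))"]) auto
    qed
  qed auto
  then have "finite (best_candidates (candidates L P lab i))" for i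
    unfolding best_candidates_def by (auto simp: Setcompr_eq_image)
  then have "\<forall>i. \<exists>xs. smallest_pairs k (best_candidates (candidates L P lab i)) xs"
    using ex_smallest_pairs by blast
  from choice[OF this] obtain r
    where "\<forall>i. smallest_pairs k (best_candidates (candidates L P lab i)) (r i)"
    by (rule exE)
  then have "is_kNNResults L P k lab (map r [0..<length P])"
    unfolding is_kNNResults_def by simp
  then show ?thesis using lab unfolding rehub_output_def by blast
qed

end

theory Submission
  imports Defs
begin

text \<open>
  The only delicate point is that truncating the backward labels to \<open>k + 1\<close> entries does not spoil
  the \<open>k\<close>-th smallest candidate distance. Let \<open>p\<close> be an object and \<open>j\<close> another one with
  \<open>dist p j \<le> d\<^sub>k p\<close>, and let \<open>u\<close> be a common hub on a shortest path. If \<open>j\<close> was cut off from the label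
  of \<open>u\<close>, that label consists of \<open>k + 1\<close> objects at least as close to \<open>u\<close> as \<open>j\<close>; at least \<open>k\<close> of them
  differ from \<open>p\<close>, and each yields a candidate distance \<open>\<le> d\<^sub>k p\<close>. So there are always \<open>k\<close> candidates
  within \<open>d\<^sub>k p\<close>, while candidate distances never underestimate, by the triangle inequality. Online,
  the hub covering \<open>q\<close> and \<open>p\<close> is within \<open>d\<^sub>k p\<close> of \<open>p\<close> whenever \<open>q\<close> is, so it survives the pruning of
  the reverse labels.
\<close>

section \<open>Order statistics\<close>

text \<open>Converse of \<open>kth_smallest_eq\<close>. The two counts characterise an order
  statistic without mentioning sorted lists, so they can be carried over from vertices to indices
  and to candidate pairs.\<close>

lemma kth_smallest_rank:
  fixes f :: "'a \<Rightarrow> 'b::linorder"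
  assumes fin: "finite A" and "1 \<le> k" and "k \<le> card A"
  defines "v \<equiv> sorted_list_of_multiset (image_mset f (mset_set A)) ! (k - 1)"
  shows "card {x \<in> A. f x < v} < k" and "k \<le> card {x \<in> A. f x \<le> v}"
proof -
  define ys where "ys = sorted_list_of_multiset (image_mset f (mset_set A))"
  have sorted: "sorted ys" and mset: "mset ys = image_mset f (mset_set A)"
    by (simp_all add: ys_def)
  have card_filter: "card {x \<in> A. Q (f x)} = card {i. i < length ys \<and> Q (ys ! i)}" for Q
  proof -
    have "length (filter Q ys) = size (filter_mset Q (mset ys))"
      by (metis mset_filter size_mset)
    also have "\<dots> = size (filter_mset (\<lambda>x. Q (f x)) (mset_set A))"
      by (simp add: mset filter_mset_image_mset)
    finally show ?thesis using fin by (simp add: length_filter_conv_card)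
  qed
  have len: "length ys = card A" using card_filter[of "\<lambda>_. True"] by simp
  have v: "v = ys ! (k - 1)" by (simp add: v_def ys_def)
  \<comment> \<open>From position \<open>k - 1\<close> on, sortedness gives entries at least
    \<open>v\<close>, so at most \<open>k - 1\<close> entries lie strictly below.\<close>
  have "{i. i < length ys \<and> ys ! i < v} \<subseteq> {..<k - 1}"
  proof (rule subsetI, rule ccontr)
    fix i assume i: "i \<in> {i. i < length ys \<and> ys ! i < v}" "i \<notin> {..<k - 1}"
    then have "v \<le> ys ! i" unfolding v using sorted by (intro sorted_nth_mono) auto
    with i show False by auto
  qed
  then have "card {x \<in> A. f x < v} \<le> card {..<k - 1}"
    unfolding card_filter[of "\<lambda>y. y < v"] by (intro card_mono) auto
  then show "card {x \<in> A. f x < v} < k" using \<open>1 \<le> k\<close> by simp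
  have "{..<k} \<subseteq> {i. i < length ys \<and> ys ! i \<le> v}"
  proof
    fix i assume "i \<in> {..<k}"
    then have "i \<le> k - 1" "k - 1 < length ys" using \<open>k \<le> card A\<close> len by auto
    then show "i \<in> {i. i < length ys \<and> ys ! i \<le> v}"
      using sorted_nth_mono[OF sorted, of i "k - 1"] unfolding v by simp
  qed
  then have "card {..<k} \<le> card {x \<in> A. f x \<le> v}"
    unfolding card_filter[of "\<lambda>y. y \<le> v"] by (intro card_mono) auto
  then show "k \<le> card {x \<in> A. f x \<le> v}" by simp
qed

text \<open>Both counts depend only on \<open>C\<close>, so the k-th distance does not vary with the
  way ties are broken, although the list may.\<close>

lemma smallest_pairs_kth:
  assumes sp: "smallest_pairs k C xs" and fin: "finite C"
    and less: "card {x \<in> C. snd x < v} < k" and le: "k \<le> card {x \<in> C. snd x \<le> v}"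
  shows "snd (xs ! (k - 1)) = v"
proof -
  have dist: "distinct xs" and sub: "set xs \<subseteq> C" and sorted: "sorted (map snd xs)"
    and rest: "\<And>x y. x \<in> set xs \<Longrightarrow> y \<in> C - set xs \<Longrightarrow> snd x \<le> snd y"
    using sp unfolding smallest_pairs_def by auto
  \<comment> \<open>Without this bound \<open>xs\<close> could be shorter than \<open>k\<close>,
    with the index \<open>k - 1\<close> out of range.\<close>
  have "k \<le> card C" using le card_mono[OF fin, of "{x \<in> C. snd x \<le> v}"] by auto
  then have len: "length xs = k" using sp unfolding smallest_pairs_def by auto
  have kpos: "0 < k" using less by auto
  have mono: "snd (xs ! i) \<le> snd (xs ! j)" if "i \<le> j" "j < k" for i j
    using sorted_nth_mono[OF sorted, of i j] that len by simp
  have "\<not> snd (xs ! (k - 1)) < v"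
  proof
    assume lt: "snd (xs ! (k - 1)) < v"
    have "snd x < v" if x: "x \<in> set xs" for x
    proof -
      obtain i where i: "i < k" "x = xs ! i" using x len by (auto simp: in_set_conv_nth)
      then have "snd x \<le> snd (xs ! (k - 1))" by (auto intro: mono)
      then show ?thesis using lt by (rule order_le_less_trans)
    qed
    then have "set xs \<subseteq> {x \<in> C. snd x < v}" using sub by auto
    then have "card (set xs) \<le> card {x \<in> C. snd x < v}" using fin by (intro card_mono) auto
    then show False using less dist len by (simp add: distinct_card)
  qed
  moreover have "\<not> v < snd (xs ! (k - 1))"
  proof
    assume gt: "v < snd (xs ! (k - 1))"
    \<comment> \<open>A pair left out of the list is at least as far as entry \<open>k - 1\<close>,
      hence beyond \<open>v\<close>. So only the positions before \<open>k - 1\<close> can hold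
      pairs within \<open>v\<close>, one too few.\<close>
    have "{x \<in> C. snd x \<le> v} \<subseteq> (!) xs ` {..<k - 1}"
    proof
      fix x assume x: "x \<in> {x \<in> C. snd x \<le> v}"
      have "x \<in> set xs"
      proof (rule ccontr)
        assume "x \<notin> set xs"
        moreover have "xs ! (k - 1) \<in> set xs" using len kpos by simp
        ultimately have "snd (xs ! (k - 1)) \<le> snd x" using rest x by blast
        with gt have "v < snd x" by (rule less_le_trans)
        then show False using x by (simp add: leD)
      qed
      then obtain i where i: "i < k" "x = xs ! i" using len by (auto simp: in_set_conv_nth)
      then have "i \<noteq> k - 1" using x gt by (auto dest: leD)
      then show "x \<in> (!) xs ` {..<k - 1}" using i by auto
    qed
    then have "card {x \<in> C. snd x \<le> v} \<le> k - 1"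
      using surj_card_le[of "{..<k - 1}"] by simp
    then show False using le kpos by simp
  qed
  ultimately show ?thesis by simp
qed

lemma finite_best_candidates: "finite C \<Longrightarrow> finite (best_candidates C)"
  unfolding best_candidates_def by (auto simp: Setcompr_eq_image)

text \<open>\<open>best_candidates\<close> is the graph of a function on indices, so counting its
  pairs amounts to counting objects.\<close>

lemma card_best_candidates:
  "card {x \<in> best_candidates C. Q (snd x)} = card {j \<in> fst ` C. Q (Min {d. (j, d) \<in> C})}"
proof -
  have "{x \<in> best_candidates C. Q (snd x)} =
      (\<lambda>j. (j, Min {d. (j, d) \<in> C})) ` {j \<in> fst ` C. Q (Min {d. (j, d) \<in> C})}"
    unfolding best_candidates_def by auto
  then show ?thesis by (simp add: card_image inj_on_def)
qed

lemma finite_candidates: "finite (candidates L P lab i)"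
proof -
  have "candidates L P lab i \<subseteq>
      (\<Union>(u, d) \<in> set (L (P ! i)). (\<lambda>(j, d'). (j, d + d')) ` set (lab u))"
    unfolding candidates_def by force
  then show ?thesis by (rule finite_subset) auto
qed

section \<open>The online phase\<close>

lemma fold_concat: "fold f (concat xss) = fold (fold f) xss"
  by (induction xss) auto

lemma fold_update_length:
  "length (fold (\<lambda>(i, x) out. if x < out ! i \<and> x \<le> t i then out[i := x] else out) xs out) = length out"
  by (induction xs arbitrary: out) auto

text \<open>An update touches a single cell, and its guard reads only that cell and a fixed bound.
  Each cell therefore evolves independently, as a running minimum of its admissible values.\<close>

lemma fold_update_nth:
  fixes out :: "'a::linorder list"
  assumes "i < length out"
  shows "fold (\<lambda>(i, x) out. if x < out ! i \<and> x \<le> t i then out[i := x] else out) xs out ! i =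
    Min (insert (out ! i) {x. (i, x) \<in> set xs \<and> x \<le> t i})" (is "fold ?upd xs out ! i = _")
proof -
  define ys where "ys xs = map snd (filter (\<lambda>(j, x). j = i \<and> x \<le> t i) xs)" for xs
  have "fold ?upd xs out ! i = fold min (ys xs) (out ! i)"
    using assms
  proof (induction xs arbitrary: out)
    case (Cons a xs)
    obtain j x where a: "a = (j, x)" by fastforce
    have "?upd a out ! i = (if j = i \<and> x \<le> t i then min x (out ! i) else out ! i)"
      using Cons.prems by (cases "j = i") (auto simp: a min_def)
    moreover have "i < length (?upd a out)" using Cons.prems by (auto simp: a)
    ultimately show ?case using Cons.IH[of "?upd a out"] by (auto simp: a ys_def)
  qed (simp add: ys_def)
  also have "\<dots> = Min (set (out ! i # ys xs))" by (rule Min.set_eq_fold[symmetric])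
  also have "set (out ! i # ys xs) = insert (out ! i) {x. (i, x) \<in> set xs \<and> x \<le> t i}"
    by (auto simp: ys_def image_iff)
  finally show ?thesis .
qed

text \<open>Flattening the nested loops into one list of updates makes
  \<open>fold_update_nth\<close> applicable.\<close>

lemma online_eq_fold_update:
  "online L P k res rlab q =
    fold (\<lambda>(i, x) out. if x < out ! i \<and> x \<le> snd (res ! i ! (k - 1)) then out[i := x] else out)
      (concat (map (\<lambda>(u, d). map (\<lambda>(i, d'). (i, d + d')) (rlab u)) (L q)))
      (replicate (length P) \<infinity>)"
  unfolding online_def fold_concat
  by (simp add: fold_map comp_def case_prod_beta' Let_def cong: if_cong)

lemma online_length: "length (online L P k res rlab q) = length P"
  by (simp add: online_eq_fold_update fold_update_length)

lemma online_nth: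
  assumes "i < length P"
  shows "online L P k res rlab q ! i = Min (insert \<infinity> {x. x \<le> snd (res ! i ! (k - 1)) \<and>
    (\<exists>u d d'. (u, d) \<in> set (L q) \<and> (i, d') \<in> set (rlab u) \<and> x = d + d')})"
proof -
  have "(i, x) \<in> set (concat (map (\<lambda>(u, d). map (\<lambda>(i, d'). (i, d + d')) (rlab u)) xs)) \<longleftrightarrow>
      (\<exists>u d d'. (u, d) \<in> set xs \<and> (i, d') \<in> set (rlab u) \<and> x = d + d')" for x xs
  proof (induction xs)
    case (Cons a xs)
    obtain u d where a: "a = (u, d)" by fastforce
    have head: "(i, x) \<in> set (map (\<lambda>(i, d'). (i, d + d')) (rlab u)) \<longleftrightarrow>
        (\<exists>d'. (i, d') \<in> set (rlab u) \<and> x = d + d')"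
      by force
    show ?case
      unfolding a list.map prod.case concat.simps set_append Un_iff head Cons.IH by auto
  qed simp
  note mem = this[of _ "L q"]
  show ?thesis
    unfolding online_eq_fold_update using assms
    by (subst fold_update_nth) (simp_all only: length_replicate nth_replicate mem conj_commute)
qed

lemma set_RkNNLab:
  "set (RkNNLab L P k res u) =
    {(i, d). i < length P \<and> (u, d) \<in> set (L (P ! i)) \<and> d \<le> snd (res ! i ! (k - 1))}"
  unfolding RkNNLab_def by (auto split: if_splits)

section \<open>Distances and hubs\<close>

lemma (in wf_digraph) gdist_le_length:
  assumes "awalk u p v"
  shows "gdist G u v \<le> ereal (length p)"
proof -
  have "awalk_cost (\<lambda>_. 1) p = length p" by (simp add: awalk_cost_def sum_list_triv)
  then show ?thesis using min_cost_le_walk_cost[OF assms, of "\<lambda>_. 1"] by (simp add: gdist_def)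
qed

text \<open>Walks are lists of named arcs, so reversal cannot in general reuse them: each arc is
  replaced by some opposite arc, which symmetry provides.\<close>

lemma (in sym_digraph) awalk_reversed:
  "awalk u p v \<Longrightarrow> \<exists>p'. awalk v p' u \<and> length p' = length p"
proof (induction p arbitrary: u)
  case Nil
  then show ?case by (intro exI[of _ "[]"]) (auto simp: awalk_Nil_iff)
next
  case (Cons e p)
  then have e: "e \<in> arcs G" "u = tail G e" and "awalk (head G e) p v"
    by (auto simp: awalk_Cons_iff)
  with Cons.IH obtain p' where p': "awalk v p' (head G e)" "length p' = length p" by blast
  obtain e' where "e' \<in> arcs G" "tail G e' = head G e" "head G e' = tail G e"
    using sym_arcs e(1) by (metis symmetric_conv)
  then have "awalk (head G e) [e'] u" using e by (auto simp: awalk_Cons_iff awalk_Nil_iff)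
  with p' show ?case by (intro exI[of _ "p' @ [e']"]) auto
qed

locale hub_labeled_graph = sym_digraph G
  for G :: "('v::linorder, 'e) pre_digraph" +
  fixes L :: "'v labeling"
  assumes labels: "hub_labeling G L" and cover: "cover_property G L"
begin

text \<open>Shortest walks exist even if \<open>G\<close> is infinite, because the cover property provides them.\<close>

lemma gdist_attained:
  assumes "s \<in> verts G" "t \<in> verts G"
  obtains p where "awalk s p t" "gdist G s t = ereal (length p)"
  using cover assms unfolding cover_property_def on_shortest_path_def
  by (metis awalkI_apath)

lemma gdist_neq_infinity:
  "s \<in> verts G \<Longrightarrow> t \<in> verts G \<Longrightarrow> gdist G s t \<noteq> \<infinity>"
  by (metis PInfty_neq_ereal(1) gdist_attained)

lemma gdist_nonneg: "s \<in> verts G \<Longrightarrow> t \<in> verts G \<Longrightarrow> 0 \<le> gdist G s t"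
  by (metis ereal_less_eq(5) gdist_attained of_nat_0_le_iff)

lemma gdist_sym:
  assumes "s \<in> verts G" "t \<in> verts G"
  shows "gdist G s t = gdist G t s"
proof -
  have "gdist G b a \<le> gdist G a b" if "a \<in> verts G" "b \<in> verts G" for a b
    using that by (metis awalk_reversed gdist_attained gdist_le_length)
  then show ?thesis using assms by (simp add: order_antisym)
qed

lemma gdist_triangle:
  assumes "s \<in> verts G" "u \<in> verts G" "t \<in> verts G"
  shows "gdist G s t \<le> gdist G s u + gdist G u t"
proof -
  obtain p p' where p: "awalk s p u" "gdist G s u = ereal (length p)"
    and p': "awalk u p' t" "gdist G u t = ereal (length p')"
    using assms by (metis gdist_attained)
  then show ?thesis using gdist_le_length[of s "p @ p'" t] by auto
qed

lemma labelD:
  "v \<in> verts G \<Longrightarrow> (u, d) \<in> set (L v) \<Longrightarrow> u \<in> verts G"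
  "v \<in> verts G \<Longrightarrow> (u, d) \<in> set (L v) \<Longrightarrow> d = gdist G v u"
  using labels unfolding hub_labeling_def by auto

text \<open>Splitting a shortest path at the covering hub gives two walks whose lengths add up to
  the distance; the triangle inequality gives the other bound. The second summand is
  \<open>gdist G t u\<close> because that is what the label of \<open>t\<close> stores.\<close>

lemma common_hub:
  assumes s: "s \<in> verts G" and t: "t \<in> verts G"
  obtains u where "u \<in> verts G" "(u, gdist G s u) \<in> set (L s)" "(u, gdist G t u) \<in> set (L t)"
    "gdist G s u + gdist G t u = gdist G s t"
proof -
  obtain u p where hubs: "u \<in> hubs L s" "u \<in> hubs L t" and p: "awalk s p t"
    and len: "ereal (length p) = gdist G s t" and u: "u \<in> set (awalk_verts s p)"
    using cover s t unfolding cover_property_def on_shortest_path_def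
    by (metis IntE awalkI_apath)
  obtain q r where qr: "p = q @ r" "awalk s q u" "awalk u r t"
    using awalk_decomp[OF p u] by blast
  have uV: "u \<in> verts G" and labs: "(u, gdist G s u) \<in> set (L s)" "(u, gdist G t u) \<in> set (L t)"
    using hubs labelD s t unfolding hubs_def by fastforce+
  have "gdist G s u + gdist G u t \<le> ereal (length q) + ereal (length r)"
    using qr by (intro add_mono gdist_le_length)
  also have "\<dots> = gdist G s t" using len qr(1) by auto
  finally have "gdist G s u + gdist G t u = gdist G s t"
    using gdist_triangle[OF s uV t] gdist_sym[OF uV t] by simp
  with that uV labs show thesis by blast
qed

section \<open>Correctness of the offline phase\<close>

text \<open>A candidate measures a detour through a hub, so the triangle inequality applies.\<close>

lemma candidate_ge_gdist:
  assumes lab: "is_kNNLab L P k lab" and P: "set P \<subseteq> verts G" and i: "i < length P"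
    and c: "(j, c) \<in> candidates L P lab i"
  shows "j < length P" "j \<noteq> i" "gdist G (P ! i) (P ! j) \<le> c"
proof -
  obtain u d d' where c: "c = d + d'" "j \<noteq> i" and ud: "(u, d) \<in> set (L (P ! i))"
    and jd: "(j, d') \<in> set (lab u)"
    using c unfolding candidates_def by auto
  then have j: "j < length P" "(u, d') \<in> set (L (P ! j))"
    using lab unfolding is_kNNLab_def smallest_pairs_def by auto
  show "j < length P" "j \<noteq> i" by fact+
  have V: "P ! i \<in> verts G" "P ! j \<in> verts G" using P i j(1) by auto
  then show "gdist G (P ! i) (P ! j) \<le> c"
    using gdist_triangle[of "P ! i" u "P ! j"] gdist_sym[of u "P ! j"]
      labelD[OF V(1) ud] labelD[OF V(2) j(2)] c by simp
qed

lemma enough_candidates: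
  assumes lab: "is_kNNLab L P k lab" and P: "set P \<subseteq> verts G" and i: "i < length P"
    and near: "k \<le> card {j. j < length P \<and> j \<noteq> i \<and> gdist G (P ! i) (P ! j) \<le> v}"
  shows "k \<le> card {j. \<exists>c \<le> v. (j, c) \<in> candidates L P lab i}" (is "k \<le> card ?K")
proof -
  have "?K \<subseteq> fst ` candidates L P lab i" by force
  then have fin: "finite ?K" by (rule finite_subset) (intro finite_imageI finite_candidates)
  let ?J = "{j. j < length P \<and> j \<noteq> i \<and> gdist G (P ! i) (P ! j) \<le> v}"
  show ?thesis
  proof (cases "?J \<subseteq> ?K")
    case True
    show ?thesis by (rule order_trans[OF near card_mono[OF fin True]])
  next
    case False
    then obtain j where j: "j < length P" "j \<noteq> i" "gdist G (P ! i) (P ! j) \<le> v" "j \<notin> ?K" by auto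
    have V: "P ! i \<in> verts G" "P ! j \<in> verts G" using P i j by auto
    obtain u where u: "(u, gdist G (P ! i) u) \<in> set (L (P ! i))"
      "(u, gdist G (P ! j) u) \<in> set (L (P ! j))"
      "gdist G (P ! i) u + gdist G (P ! j) u = gdist G (P ! i) (P ! j)"
      using common_hub[OF V] by metis
    let ?C = "{(i, d). i < length P \<and> (u, d) \<in> set (L (P ! i))}"
    have "smallest_pairs (k + 1) ?C (lab u)" using lab unfolding is_kNNLab_def by simp
    then have dist: "distinct (lab u)" and sub: "set (lab u) \<subseteq> ?C"
      and len: "length (lab u) = min (k + 1) (card ?C)"
      and rest: "\<forall>x \<in> set (lab u). \<forall>y \<in> ?C - set (lab u). snd x \<le> snd y"
      unfolding smallest_pairs_def by simp_all
    \<comment> \<open>The route through \<open>u\<close> to \<open>j\<close> is a shortest one, and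
      the route through \<open>u\<close> to \<open>m\<close> is no longer.\<close>
    have memK: "m \<in> ?K" if "(m, d) \<in> set (lab u)" "m \<noteq> i" "d \<le> gdist G (P ! j) u" for m d
    proof -
      have "(m, gdist G (P ! i) u + d) \<in> candidates L P lab i"
        using that u(1) unfolding candidates_def by blast
      moreover have "gdist G (P ! i) u + d \<le> v"
        using add_left_mono[OF that(3), of "gdist G (P ! i) u"] u(3) j(3) by simp
      ultimately show ?thesis by blast
    qed
    \<comment> \<open>Had \<open>j\<close> kept its place in the label of \<open>u\<close>,
      \<open>memK\<close> would make it a candidate within \<open>v\<close>.\<close>
    have cut: "(j, gdist G (P ! j) u) \<in> ?C - set (lab u)"
    proof
      show "(j, gdist G (P ! j) u) \<in> ?C" using j(1) u(2) by simp
      show "(j, gdist G (P ! j) u) \<notin> set (lab u)" using memK[OF _ j(2) order_refl] j(4) by iprover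
    qed
    have "?C \<subseteq> (SIGMA i : {..<length P}. snd ` set (L (P ! i)))" by force
    then have "finite ?C" by (rule finite_subset) auto
    \<comment> \<open>The missing pair makes the label a proper subset, so the minimum in
      \<open>len\<close> is \<open>k + 1\<close> rather than the size of \<open>?C\<close>.\<close>
    moreover have "set (lab u) \<subset> ?C" using sub cut by blast
    ultimately have "card (set (lab u)) < card ?C" by (rule psubset_card_mono)
    moreover have "card (set (lab u)) = length (lab u)"
      using dist by (rule distinct_card)
    ultimately have "card (set (lab u)) = k + 1" using len by simp
    \<comment> \<open>Distinct pairs belong to distinct objects, since the hub labeling fixes the
      distance from each object to \<open>u\<close>.\<close>
    have "inj_on fst (set (lab u))"
    proof (rule inj_onI)
      fix x y assume xy: "x \<in> set (lab u)" "y \<in> set (lab u)" "fst x = fst y"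
      have "snd z = gdist G (P ! fst z) u" if "z \<in> set (lab u)" for z
      proof -
        have "z \<in> ?C" using that sub by (rule subsetD[rotated])
        then have z: "fst z < length P" "(u, snd z) \<in> set (L (P ! fst z))" by auto
        then have "P ! fst z \<in> verts G" using P nth_mem by blast
        then show ?thesis using z(2) by (rule labelD(2))
      qed
      then show "x = y" using xy by (simp add: prod_eq_iff)
    qed
    then have "card (fst ` set (lab u)) = k + 1"
      using \<open>card (set (lab u)) = k + 1\<close> by (simp add: card_image)
    \<comment> \<open>The spare entry pays for the possible presence of object \<open>i\<close>
      itself.\<close>
    then have "k \<le> card (fst ` set (lab u) - {i})" by (simp add: card_Diff_singleton_if)
    also have "\<dots> \<le> card ?K"
    proof (rule card_mono[OF fin])
      show "fst ` set (lab u) - {i} \<subseteq> ?K"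
      proof
        fix m assume "m \<in> fst ` set (lab u) - {i}"
        then obtain d where md: "(m, d) \<in> set (lab u)" "m \<noteq> i" by auto
        have "snd (m, d) \<le> snd (j, gdist G (P ! j) u)"
          by (rule bspec[OF bspec[OF rest md(1)] cut])
        then show "m \<in> ?K" using memK[OF md] by simp
      qed
    qed
    finally show ?thesis .
  qed
qed

lemma kNNResults_kth:
  assumes lab: "is_kNNLab L P k lab" and res: "is_kNNResults L P k lab res"
    and dist: "distinct P" and P: "set P \<subseteq> verts G" and k: "1 \<le> k" "k + 1 \<le> length P"
    and i: "i < length P"
  shows "snd (res ! i ! (k - 1)) = kNN_dist G P k (P ! i)"
proof -
  define v where "v = kNN_dist G P k (P ! i)"
  define C where "C = candidates L P lab i"
  have fin: "finite C" by (simp add: C_def finite_candidates)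
  then have fin': "finite {d. (j, d) \<in> C}" for j
    by (rule finite_subset[rotated, OF finite_imageI[of _ snd]]) force
  \<comment> \<open>Neighbors are counted as vertices, candidates as indices; distinctness of
    \<open>P\<close> makes the two counts agree.\<close>
  have card_A: "card {x \<in> set P - {P ! i}. Q x} = card {j. j < length P \<and> j \<noteq> i \<and> Q (P ! j)}" for Q
  proof -
    have "{x \<in> set P - {P ! i}. Q x} = (!) P ` {j. j < length P \<and> j \<noteq> i \<and> Q (P ! j)}"
      using dist i by (auto simp: in_set_conv_nth nth_eq_iff_index_eq)
    moreover have "inj_on ((!) P) {j. j < length P \<and> j \<noteq> i \<and> Q (P ! j)}"
      using dist by (auto intro!: inj_on_nth)
    ultimately show ?thesis by (simp add: card_image)
  qed
  have "card (set P - {P ! i}) = length P - 1" using dist i by (simp add: distinct_card)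
  then have rank: "card {x \<in> set P - {P ! i}. gdist G (P ! i) x < v} < k"
    "k \<le> card {x \<in> set P - {P ! i}. gdist G (P ! i) x \<le> v}"
    unfolding v_def kNN_dist_def
    using kth_smallest_rank[of "set P - {P ! i}" k "gdist G (P ! i)"] k by simp_all
  have "card {x \<in> best_candidates C. snd x < v} = card {j \<in> fst ` C. Min {d. (j, d) \<in> C} < v}"
    by (rule card_best_candidates)
  \<comment> \<open>By finiteness the minimum is itself a candidate distance of \<open>j\<close>,
    hence an upper bound on the true distance.\<close>
  also have "\<dots> \<le> card {j. j < length P \<and> j \<noteq> i \<and> gdist G (P ! i) (P ! j) < v}"
  proof (rule card_mono)
    show "{j \<in> fst ` C. Min {d. (j, d) \<in> C} < v} \<subseteq>
        {j. j < length P \<and> j \<noteq> i \<and> gdist G (P ! i) (P ! j) < v}"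
    proof
      fix j assume j: "j \<in> {j \<in> fst ` C. Min {d. (j, d) \<in> C} < v}"
      then have "(j, Min {d. (j, d) \<in> C}) \<in> C"
        using Min_in[OF fin', of j] by force
      from candidate_ge_gdist[OF lab P i this[unfolded C_def]] j
      show "j \<in> {j. j < length P \<and> j \<noteq> i \<and> gdist G (P ! i) (P ! j) < v}"
        by (auto simp: C_def)
    qed
  qed simp
  also have "\<dots> < k" using rank(1) card_A[of "\<lambda>x. gdist G (P ! i) x < v"] by simp
  finally have less: "card {x \<in> best_candidates C. snd x < v} < k" .
  have "k \<le> card {j. \<exists>c \<le> v. (j, c) \<in> C}"
    unfolding C_def using rank(2) card_A[of "\<lambda>x. gdist G (P ! i) x \<le> v"]
    by (intro enough_candidates[OF lab P i]) simp
  also have "\<dots> \<le> card {j \<in> fst ` C. Min {d. (j, d) \<in> C} \<le> v}"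
  proof (rule card_mono)
    show "{j. \<exists>c \<le> v. (j, c) \<in> C} \<subseteq> {j \<in> fst ` C. Min {d. (j, d) \<in> C} \<le> v}"
    proof
      fix j assume "j \<in> {j. \<exists>c \<le> v. (j, c) \<in> C}"
      then obtain c where c: "c \<le> v" "(j, c) \<in> C" by blast
      then have "Min {d. (j, d) \<in> C} \<le> c" using fin' by (intro Min_le) auto
      then have "Min {d. (j, d) \<in> C} \<le> v" using c(1) by (rule order_trans)
      moreover have "j \<in> fst ` C" using c(2) by force
      ultimately show "j \<in> {j \<in> fst ` C. Min {d. (j, d) \<in> C} \<le> v}" by blast
    qed
  qed (use fin in simp)
  also have "\<dots> = card {x \<in> best_candidates C. snd x \<le> v}"
    by (rule card_best_candidates[symmetric])
  finally have le: "k \<le> card {x \<in> best_candidates C. snd x \<le> v}" .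
  have "smallest_pairs k (best_candidates C) (res ! i)"
    using res i unfolding is_kNNResults_def C_def by blast
  then show ?thesis
    using smallest_pairs_kth finite_best_candidates[OF fin] less le unfolding v_def by blast
qed

section \<open>Correctness of the online phase\<close>

lemma rehub_output_nth:
  assumes out: "rehub_output L P k q out" and dist: "distinct P" and P: "set P \<subseteq> verts G"
    and k: "1 \<le> k" "k + 1 \<le> length P" and q: "q \<in> verts G" and i: "i < length P"
  shows "out ! i = (if P ! i \<in> RkNN G P k q then gdist G q (P ! i) else \<infinity>)"
proof -
  obtain lab res where lab: "is_kNNLab L P k lab" and res: "is_kNNResults L P k lab res"
    and out: "out = online L P k res (RkNNLab L P k res) q"
    using out unfolding rehub_output_def by blast
  define v where "v = kNN_dist G P k (P ! i)"
  have kth: "snd (res ! i ! (k - 1)) = v"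
    unfolding v_def by (rule kNNResults_kth[OF lab res dist P k i])
  have V: "P ! i \<in> verts G" using P i by auto
  define S where "S = {x. x \<le> v \<and> (\<exists>u d d'. (u, d) \<in> set (L q) \<and>
    (u, d') \<in> set (L (P ! i)) \<and> d' \<le> v \<and> x = d + d')}"
  have out_i: "out ! i = Min (insert \<infinity> S)"
    unfolding out S_def online_nth[OF i] set_RkNNLab kth using i kth by simp
  have "S \<subseteq> (\<lambda>((u, d), (u', d')). d + d') ` (set (L q) \<times> set (L (P ! i)))"
    unfolding S_def by force
  then have fin: "finite S" by (rule finite_subset) auto
  have lower: "gdist G q (P ! i) \<le> x" if x: "x \<in> S" for x
  proof -
    obtain u d d' where u: "(u, d) \<in> set (L q)" "(u, d') \<in> set (L (P ! i))" "x = d + d'"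
      using x unfolding S_def by auto
    then show ?thesis
      using gdist_triangle[of q u "P ! i"] gdist_sym[of u "P ! i"] labelD[OF q u(1)]
        labelD[OF V u(2)] q V by simp
  qed
  have RkNN: "P ! i \<in> RkNN G P k q \<longleftrightarrow> gdist G q (P ! i) \<le> v"
    using i gdist_sym[OF q V] by (simp add: RkNN_def v_def)
  show ?thesis
  proof (cases "gdist G q (P ! i) \<le> v")
    case True
    obtain u where u: "u \<in> verts G" "(u, gdist G q u) \<in> set (L q)"
      "(u, gdist G (P ! i) u) \<in> set (L (P ! i))"
      "gdist G q u + gdist G (P ! i) u = gdist G q (P ! i)"
      using common_hub[OF q V] by metis
    \<comment> \<open>The covering hub lies no farther from the object than \<open>q\<close> does,
      so its entry passes the offline pruning.\<close>
    have "gdist G (P ! i) u \<le> gdist G q u + gdist G (P ! i) u"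
      using gdist_nonneg[OF q u(1)] by (metis add_0 add_right_mono)
    then have "gdist G q (P ! i) \<in> S"
      unfolding S_def using True u by fastforce
    then show ?thesis
      unfolding out_i using True RkNN fin lower by (auto intro!: Min_eqI)
  next
    case False
    \<comment> \<open>Every sum is at least the distance, which already exceeds \<open>v\<close>;
      the guard admits none and the initial infinity remains.\<close>
    then have "S = {}" using lower unfolding S_def by force
    then show ?thesis using False RkNN out_i by simp
  qed
qed

end

theorem theorem1:
  fixes G :: "('v::linorder, 'e) pre_digraph"
    and L :: "'v labeling" and P :: "'v list" and k :: nat and q :: 'v and out :: "ereal list"
  assumes "loopfree_digraph G" and "nomulti_digraph G" and "sym_digraph G" and "connected G"
    and "hub_labeling G L" and "cover_property G L"
    and "distinct P" and "set P \<subseteq> verts G"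
    and "1 \<le> k" and "k + 1 \<le> length P"
    and "q \<in> verts G"
    and "rehub_output L P k q out"
  shows "length out = length P
    \<and> (\<forall>i < length P. out ! i = (if P ! i \<in> RkNN G P k q then gdist G q (P ! i) else \<infinity>))
    \<and> {P ! i | i. i < length P \<and> out ! i \<noteq> \<infinity>} = RkNN G P k q"
proof -
  interpret sym_digraph G by fact
  interpret hub_labeled_graph G L by unfold_locales fact+
  have len: "length out = length P"
    using \<open>rehub_output L P k q out\<close> by (auto simp: rehub_output_def online_length)
  have nth: "out ! i = (if P ! i \<in> RkNN G P k q then gdist G q (P ! i) else \<infinity>)"
    if "i < length P" for i
    by (rule rehub_output_nth) (fact assms that)+
  \<comment> \<open>Infinity marks exactly the rejected indices because distances between vertices
    are finite.\<close>
  have "out ! i \<noteq> \<infinity> \<longleftrightarrow> P ! i \<in> RkNN G P k q" if "i < length P" for i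
  proof -
    have "P ! i \<in> verts G" using \<open>set P \<subseteq> verts G\<close> that nth_mem by blast
    then have "gdist G q (P ! i) \<noteq> \<infinity>" by (rule gdist_neq_infinity[OF \<open>q \<in> verts G\<close>])
    then show ?thesis using nth[OF that] by simp
  qed
  then have "{P ! i | i. i < length P \<and> out ! i \<noteq> \<infinity>} =
      {P ! i | i. i < length P \<and> P ! i \<in> RkNN G P k q}"
    by blast
  also have "\<dots> = RkNN G P k q"
    by (auto simp: RkNN_def in_set_conv_nth)
  finally show ?thesis using len nth by blast
qed

end
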